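(* All eigenvalues of the matrix $A(\rho)$ are located in the set $\mathcal{D}$ for all uncertainties $\rho\in\Delta$ if and only if the solution (optimal value) of the following (nonconvex) optimization problem is $0$: $$\max_{x\in\mathbb{C}^{n_a},\ \rho\in\Delta,\ \lambda\in\mathbb{C}}\ \|x\|_2^2\qquad\text{s.t.}\quad (A(\rho)-\lambda I)x=0,\quad \|x\|_2^2\le 1,\quad \lambda\in\mathcal{D}^c.$$
   Context: Setting. $A(\rho)$ is a real square matrix of size $n_a\times n_a$ whose entries are real polynomials in the uncertain parameter vector $\rho\in\mathbb{R}^{n_\rho}$. The uncertainty set is the compact semialgebraic set $\Delta=\{\rho\in\mathbb{R}^{n_\rho}: g_i(\rho)\ge 0,\ i=1,\dots,n_g\}$, with $g_i$ real polynomials. The stability region $\mathcal{D}\subseteq\mathbb{C}$ is an open set whose complement is the closed semialgebraic set $\mathcal{D}^c=\mathbb{C}\setminus\mathcal{D}=\{\lambda=\lambda_{\mathrm{re}}+j\lambda_{\mathrm{im}}\in\mathbb{C}:\ \lambda_{\mathrm{re}},\lambda_{\mathrm{im}}\in\mathbb{R},\ d_i(\lambda_{\mathrm{re}},\lambda_{\mathrm{im}})\ge 0,\ i=1,\dots,n_d\}$, with $d_i$ real polynomials in the two real variables $\lambda_{\mathrm{re}},\lambda_{\mathrm{im}}$. $I$ is the $n_a\times n_a$ identity matrix and $\|\cdot\|_2$ the Euclidean norm on $\mathbb{C}^{n_a}$.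
   Formalization: The uncertainty set Δ is assumed nonempty and the stability region D is assumed different from ℂ; otherwise the problem is infeasible and has no maximum, although the eigenvalue condition holds trivially. *)

theory Defs
  imports "HOL-Analysis.Analysis"
begin

text \<open>
  Matrices and vectors are indexed by finite types: \<open>'n\<close> indexes the rows and columns
  of the system matrix, \<open>'r\<close> the uncertain parameters. The matrices are real, but their
  eigenvalues and eigenvectors are taken over the complex numbers, hence the entrywise
  embedding \<open>map_matrix complex_of_real\<close>. The matrix \<open>mat l\<close> is \<open>l\<close> times the identity,
  and \<open>norm\<close> on \<open>complex ^ 'n\<close> is the Euclidean norm.
\<close>

definition eigenvalue :: "real ^ 'n ^ 'n \<Rightarrow> complex \<Rightarrow> bool" where
  "eigenvalue M l \<longleftrightarrow>
     (\<exists>v :: complex ^ 'n. v \<noteq> 0 \<and> map_matrix complex_of_real M *v v = l *s v)"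

definition basic_closed_semialgebraic :: "nat \<Rightarrow> (nat \<Rightarrow> 'a \<Rightarrow> real) \<Rightarrow> 'a set" where
  "basic_closed_semialgebraic m p = {z. \<forall>i\<in>{1..m}. p i z \<ge> 0}"

definition feasible ::
  "(real ^ 'r \<Rightarrow> real ^ 'n ^ 'n) \<Rightarrow> (real ^ 'r) set \<Rightarrow> complex set
    \<Rightarrow> ((complex ^ 'n) \<times> (real ^ 'r) \<times> complex) set" where
  "feasible A \<Delta> D =
     {(x, \<rho>, l). \<rho> \<in> \<Delta> \<and> (map_matrix complex_of_real (A \<rho>) - mat l) *v x = 0
        \<and> (norm x)\<^sup>2 \<le> 1 \<and> l \<in> - D}"

text \<open>
  \<open>max_value f S v\<close>: the maximum of \<open>f\<close> over \<open>S\<close> exists (is attained) and equals \<open>v\<close>.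
  No \<open>v\<close> satisfies this when \<open>S\<close> is empty.
\<close>

definition max_value :: "('a \<Rightarrow> real) \<Rightarrow> 'a set \<Rightarrow> real \<Rightarrow> bool" where
  "max_value f S v \<longleftrightarrow> (\<exists>z\<in>S. f z = v) \<and> (\<forall>z\<in>S. f z \<le> v)"

end

theory Submission
  imports Defs
begin

text \<open>A feasible point with \<open>x \<noteq> 0\<close> is precisely an eigenvector in the
  unit ball for an eigenvalue of some \<open>A \<rho>\<close>, \<open>\<rho> \<in> \<Delta>\<close>,
  that lies outside \<open>D\<close> (\<open>mem_feasible_iff\<close>). If no such eigenvalue
  exists, only \<open>x = 0\<close> is feasible and the maximum is 0. If one exists, its eigenvector
  can be rescaled to norm 1 (\<open>eigenvalue_unit_vector\<close>), so the objective reaches 1. The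
  optimum thus only takes the values 0 and 1.\<close>

lemma mat_mult_vec: "mat l *v x = l *s x"
  for x :: "'a::comm_semiring_1 ^ 'n"
  by (simp add: vec_eq_iff matrix_vector_mult_def mat_def if_distrib if_distribR cong: if_cong)

lemma of_real_vector_scalar_mult: "of_real c *s x = c *\<^sub>R x"
  for x :: "'a::real_algebra_1 ^ 'n"
  by (simp add: vec_eq_iff scaleR_conv_of_real[where 'a = 'a])

text \<open>Puts the kernel condition into the form of the equation in \<open>eigenvalue\<close>, so
  that the two can be matched directly.\<close>

lemma mem_feasible_iff:
  "(x, \<rho>, l) \<in> feasible A \<Delta> D \<longleftrightarrow>
     \<rho> \<in> \<Delta> \<and> map_matrix complex_of_real (A \<rho>) *v x = l *s x \<and> (norm x)\<^sup>2 \<le> 1 \<and> l \<notin> D"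
  by (simp add: feasible_def matrix_vector_mult_diff_rdistrib mat_mult_vec)

text \<open>Eigenvectors are closed under nonzero scaling, so one can be normalised.\<close>

lemma eigenvalue_unit_vector:
  fixes M :: "real ^ 'n ^ 'n"
  assumes "eigenvalue M l"
  obtains x :: "complex ^ 'n"
  where "norm x = 1" and "map_matrix complex_of_real M *v x = l *s x"
proof -
  obtain v :: "complex ^ 'n" where v: "v \<noteq> 0" "map_matrix complex_of_real M *v v = l *s v"
    using assms by (auto simp: eigenvalue_def)
  define x where "x = complex_of_real (inverse (norm v)) *s v"
  have "norm x = 1"
    \<comment> \<open>The scalar is real, so the product becomes a real scaling, for which the norm
      is homogeneous.\<close>
    using v(1) unfolding x_def of_real_vector_scalar_mult by simp
  moreover have "map_matrix complex_of_real M *v x = l *s x"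
    by (simp add: x_def vector_scalar_commute v(2) vector_smult_assoc mult.commute)
  ultimately show thesis
    by (rule that)
qed

theorem theorem2:
  fixes A :: "real ^ 'r \<Rightarrow> real ^ 'n ^ 'n"
    and g :: "nat \<Rightarrow> real ^ 'r \<Rightarrow> real" and n_g :: nat
    and d :: "nat \<Rightarrow> real \<times> real \<Rightarrow> real" and n_d :: nat
    and \<Delta> :: "(real ^ 'r) set" and D :: "complex set"
  assumes A_poly: "\<And>i j. real_polynomial_function (\<lambda>\<rho>. A \<rho> $ i $ j)"
    and g_poly: "\<And>i. i \<in> {1..n_g} \<Longrightarrow> real_polynomial_function (g i)"
    and d_poly: "\<And>i. i \<in> {1..n_d} \<Longrightarrow> real_polynomial_function (d i)"
    and \<Delta>_eq: "\<Delta> = basic_closed_semialgebraic n_g g"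
    and \<Delta>_compact: "compact \<Delta>"
    and \<Delta>_nonempty: "\<Delta> \<noteq> {}"
    and D_open: "open D"
    and D_compl: "- D = basic_closed_semialgebraic n_d (\<lambda>i l. d i (Re l, Im l))"
    and D_proper: "D \<noteq> UNIV"
  shows "(\<forall>\<rho>\<in>\<Delta>. \<forall>l. eigenvalue (A \<rho>) l \<longrightarrow> l \<in> D) \<longleftrightarrow>
         max_value (\<lambda>(x :: complex ^ 'n, \<rho>, l). (norm x)\<^sup>2) (feasible A \<Delta> D) 0"
proof
  assume stable: "\<forall>\<rho>\<in>\<Delta>. \<forall>l. eigenvalue (A \<rho>) l \<longrightarrow> l \<in> D"
  \<comment> \<open>The zero vector solves the eigenvector equation for every \<open>\<rho>\<close>
    and \<open>l\<close>; any choice in \<open>\<Delta>\<close> and \<open>- D\<close> thus attains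
    the value 0.\<close>
  obtain \<rho> l where "\<rho> \<in> \<Delta>" "l \<notin> D"
    using \<Delta>_nonempty D_proper by blast
  then have "(0 :: complex ^ 'n, \<rho>, l) \<in> feasible A \<Delta> D"
    by (simp add: mem_feasible_iff)
  moreover have "x = 0" if "(x, \<rho>, l) \<in> feasible A \<Delta> D" for x :: "complex ^ 'n" and \<rho> l
    using that stable unfolding mem_feasible_iff eigenvalue_def by blast
  ultimately show "max_value (\<lambda>(x :: complex ^ 'n, \<rho>, l). (norm x)\<^sup>2) (feasible A \<Delta> D) 0"
    unfolding max_value_def by (fastforce split: prod.splits)
next
  assume max0: "max_value (\<lambda>(x :: complex ^ 'n, \<rho>, l). (norm x)\<^sup>2) (feasible A \<Delta> D) 0"
  show "\<forall>\<rho>\<in>\<Delta>. \<forall>l. eigenvalue (A \<rho>) l \<longrightarrow> l \<in> D"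
  proof (intro ballI allI impI, rule ccontr)
    fix \<rho> l
    assume "\<rho> \<in> \<Delta>" "eigenvalue (A \<rho>) l" "l \<notin> D"
    \<comment> \<open>A unit eigenvector meets the norm constraint with equality, and its objective
      value 1 exceeds the supposed maximum 0.\<close>
    then obtain x where "norm x = 1" "(x, \<rho>, l) \<in> feasible A \<Delta> D"
      by (metis eigenvalue_unit_vector mem_feasible_iff one_power2 order_refl)
    with max0 show False
      by (auto simp: max_value_def dest!: bspec)
  qed
qed

end
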